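(* Let $k\ge 2$. The maximal 2-subgroup $G_k$ of $\mathrm{Aut}\,X^{[k]}$ that acts by even permutations on $X^k$ is the inner semidirect product $G_k = B_{k-1}\ltimes W_{k-1}$ (with $W_{k-1}$ normal and $B_{k-1}$ acting on $W_{k-1}$ by conjugation in $\mathrm{Aut}\,X^{[k]}$).
   Context: $X^{[k]}$ is the rooted binary tree with levels $X^0,X^1,\ldots,X^k$. Level $X^j$ consists of $2^j$ vertices $v_{j,1},\ldots,v_{j,2^j}$ numbered from left to right, so the children of $v_{j,i}$ ($j<k$) are $v_{j+1,2i-1}$ and $v_{j+1,2i}$. An automorphism $g\in\mathrm{Aut}\,X^{[k]}$ (fixing the root) is determined by its portrait: for every vertex $v_{j,i}$ with $0\le j\le k-1$, if $g(v_{j,i})=v_{j,m}$, then the state of $g$ at $v_{j,i}$ is trivial if $g(v_{j+1,2i-1})=v_{j+1,2m-1}$, and non-trivial (active) if $g(v_{j+1,2i-1})=v_{j+1,2m}$. Any assignment of trivial/active states to the vertices of levels $0,\ldots,k-1$ is the portrait of a unique automorphism. $\mathrm{Aut}\,X^{[k]}$ is itself a finite 2-group, and $G_k$ is the subgroup of all automorphisms that act on the $2^k$ vertices of $X^k$ by even permutations. $B_{k-1}\cong \underbrace{C_2\wr\cdots\wr C_2}_{k-1}$ is the subgroup of automorphisms all of whose active states lie on levels $X^0,\ldots,X^{k-2}$ (the copy of $\mathrm{Aut}\,X^{[k-1]}$ in $\mathrm{Aut}\,X^{[k]}$). $W_{k-1}$ is the subgroup of those elements of $G_k$ all of whose active states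 lie on $X^{k-1}$. *)

theory Defs
  imports "HOL-Algebra.Algebra" "HOL-Combinatorics.Combinatorics"
begin

text \<open>The vertex \<open>v\<^sub>j\<^sub>,\<^sub>i\<close> of the binary tree is the pair \<open>(j, i)\<close>, where \<open>i\<close> counts from 1.\<close>

definition tree_level :: "nat \<Rightarrow> (nat \<times> nat) set" where
  "tree_level j = {j} \<times> {1..2 ^ j}"

definition tree_verts :: "nat \<Rightarrow> (nat \<times> nat) set" where
  "tree_verts k = (\<Union>j\<le>k. tree_level j)"

definition tree_root :: "nat \<times> nat" where
  "tree_root = (0, 1)"

definition tree_child :: "nat \<times> nat \<Rightarrow> nat \<times> nat \<Rightarrow> bool" where
  "tree_child u v \<longleftrightarrow>
     fst v = Suc (fst u) \<and> (snd v = 2 * snd u - 1 \<or> snd v = 2 * snd u)"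

definition tree_adj :: "nat \<times> nat \<Rightarrow> nat \<times> nat \<Rightarrow> bool" where
  "tree_adj u v \<longleftrightarrow> tree_child u v \<or> tree_child v u"

text \<open>
  As in \<^const>\<open>BijGroup\<close>, automorphisms are functions on the finite vertex set that are
  \<^const>\<open>undefined\<close> outside it, and the product \<open>g \<otimes> h\<close> applies \<open>h\<close> first.
\<close>

definition tree_auts :: "nat \<Rightarrow> (nat \<times> nat \<Rightarrow> nat \<times> nat) set" where
  "tree_auts k = {g \<in> Bij (tree_verts k). g tree_root = tree_root \<and>
     (\<forall>u\<in>tree_verts k. \<forall>v\<in>tree_verts k. tree_adj (g u) (g v) \<longleftrightarrow> tree_adj u v)}"

definition AutTree :: "nat \<Rightarrow> (nat \<times> nat \<Rightarrow> nat \<times> nat) monoid" where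
  "AutTree k = BijGroup (tree_verts k) \<lparr>carrier := tree_auts k\<rparr>"

text \<open>The state of \<open>g\<close> at \<open>v\<^sub>j\<^sub>,\<^sub>i\<close> is non-trivial; meaningful only for \<open>j < k\<close>, \<open>1 \<le> i \<le> 2\<^sup>j\<close>.\<close>

definition active :: "(nat \<times> nat \<Rightarrow> nat \<times> nat) \<Rightarrow> nat \<Rightarrow> nat \<Rightarrow> bool" where
  "active g j i \<longleftrightarrow> (\<exists>m. g (j, i) = (j, m) \<and> g (Suc j, 2 * i - 1) = (Suc j, 2 * m))"

definition even_on_level :: "nat \<Rightarrow> (nat \<times> nat \<Rightarrow> nat \<times> nat) \<Rightarrow> bool" where
  "even_on_level k g \<longleftrightarrow> evenperm (perm_restrict g (tree_level k))"

definition G_sub :: "nat \<Rightarrow> (nat \<times> nat \<Rightarrow> nat \<times> nat) set" where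
  "G_sub k = {g \<in> carrier (AutTree k). even_on_level k g}"

text \<open>
  \<open>B_sub k\<close> and \<open>W_sub k\<close> are \<open>B\<^sub>k\<^sub>-\<^sub>1\<close> and \<open>W\<^sub>k\<^sub>-\<^sub>1\<close>: both consist of automorphisms of the tree
  of depth \<open>k\<close>, with active states only on levels \<open>0, \<dots>, k - 2\<close> and only on level \<open>k - 1\<close>,
  respectively.
\<close>

definition B_sub :: "nat \<Rightarrow> (nat \<times> nat \<Rightarrow> nat \<times> nat) set" where
  "B_sub k = {g \<in> carrier (AutTree k).
     \<forall>j<k. \<forall>i\<in>{1..2 ^ j}. active g j i \<longrightarrow> j + 2 \<le> k}"

definition W_sub :: "nat \<Rightarrow> (nat \<times> nat \<Rightarrow> nat \<times> nat) set" where
  "W_sub k = {g \<in> G_sub k.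
     \<forall>j<k. \<forall>i\<in>{1..2 ^ j}. active g j i \<longrightarrow> j + 1 = k}"

definition p_subgroup :: "nat \<Rightarrow> 'a set \<Rightarrow> ('a, 'b) monoid_scheme \<Rightarrow> bool" where
  "p_subgroup p H G \<longleftrightarrow> subgroup H G \<and> (\<exists>n. card H = p ^ n)"

text \<open>\<open>G\<close> is the inner semidirect product of its subgroup \<open>B\<close> and its normal subgroup \<open>W\<close>.\<close>

definition inner_semidirect :: "('a, 'b) monoid_scheme \<Rightarrow> 'a set \<Rightarrow> 'a set \<Rightarrow> bool" where
  "inner_semidirect G B W \<longleftrightarrow>
     subgroup B G \<and> W \<lhd> G \<and> B \<inter> W = {\<one>\<^bsub>G\<^esub>} \<and> B <#>\<^bsub>G\<^esub> W = carrier G"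

definition conj_map :: "('a, 'b) monoid_scheme \<Rightarrow> 'a set \<Rightarrow> 'a \<Rightarrow> 'a \<Rightarrow> 'a" where
  "conj_map G W b = (\<lambda>w\<in>W. b \<otimes>\<^bsub>G\<^esub> w \<otimes>\<^bsub>G\<^esub> inv\<^bsub>G\<^esub> b)"

end

theory Submission
  imports Defs
begin

text \<open>
  By induction \<open>g ^ (2 ^ j)\<close> fixes level \<open>j\<close> pointwise, so every automorphism has 2-power
  order and, by Sylow's theorem, every subgroup of the automorphism group is a 2-group.

  \<open>B\<^sub>k\<^sub>-\<^sub>1\<close> consists of the automorphisms that preserve the parity of the positions on level
  \<open>k\<close>, \<open>W\<^sub>k\<^sub>-\<^sub>1\<close> of the even ones that fix all levels above it. Given \<open>g\<close> in \<open>G\<^sub>k\<close>, let \<open>b\<close> in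
  \<open>B\<^sub>k\<^sub>-\<^sub>1\<close> agree with \<open>g\<close> above level \<open>k\<close>. Elements of \<open>B\<^sub>k\<^sub>-\<^sub>1\<close> are even on level \<open>k\<close>, hence
  \<open>b\<inverse> g\<close> lies in \<open>W\<^sub>k\<^sub>-\<^sub>1\<close>.
\<close>

section \<open>Automorphisms of the tree\<close>

text \<open>The indices \<open>2 * m - 1\<close> and \<open>2 * m\<close> are both sent to
  \<open>m\<close>. Truncated subtraction makes the root its own parent, which is why level 0 is
  excluded where a genuine parent is meant.\<close>

definition tree_parent :: "nat \<times> nat \<Rightarrow> nat \<times> nat" where
  "tree_parent v = (fst v - 1, (snd v + 1) div 2)"

lemma in_tree_verts_iff: "v \<in> tree_verts k \<longleftrightarrow> fst v \<le> k \<and> 1 \<le> snd v \<and> snd v \<le> 2 ^ fst v"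
  by (cases v) (auto simp: tree_verts_def tree_level_def)

lemma in_tree_level_iff: "v \<in> tree_level j \<longleftrightarrow> fst v = j \<and> 1 \<le> snd v \<and> snd v \<le> 2 ^ j"
  by (cases v) (auto simp: tree_level_def)

lemma tree_level_subset: "j \<le> k \<Longrightarrow> tree_level j \<subseteq> tree_verts k"
  by (auto simp: tree_verts_def)

lemma finite_tree_level: "finite (tree_level j)"
  by (simp add: tree_level_def)

lemma finite_tree_verts: "finite (tree_verts k)"
  by (simp add: tree_verts_def finite_tree_level)

lemma tree_child_iff:
  assumes "u \<in> tree_verts k" "v \<in> tree_verts k"
  shows "tree_child u v \<longleftrightarrow> fst v \<noteq> 0 \<and> u = tree_parent v"
  using assms by (cases u; cases v) (auto simp: tree_child_def tree_parent_def in_tree_verts_iff)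

lemma tree_parent_in_verts:
  assumes "v \<in> tree_verts k" "fst v \<noteq> 0"
  shows "tree_parent v \<in> tree_verts k"
proof -
  obtain j i where v: "v = (Suc j, i)"
    using assms(2) by (metis not0_implies_Suc prod.collapse)
  show ?thesis
    using assms(1) by (auto simp: v tree_parent_def in_tree_verts_iff)
qed

lemma auts_Bij: "g \<in> tree_auts k \<Longrightarrow> g \<in> Bij (tree_verts k)"
  by (simp add: tree_auts_def)

lemma auts_in_verts: "g \<in> tree_auts k \<Longrightarrow> v \<in> tree_verts k \<Longrightarrow> g v \<in> tree_verts k"
  using Bij_imp_funcset[OF auts_Bij] by blast

lemma auts_inj_on: "g \<in> tree_auts k \<Longrightarrow> inj_on g (tree_verts k)"
  using auts_Bij by (auto simp: Bij_def bij_betw_def)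

text \<open>By induction on the level. A vertex \<open>v\<close> is adjacent to its parent
  \<open>u\<close>, so \<open>g v\<close> is either a child or the parent of \<open>g u\<close>. In
  the second case the induction hypothesis for \<open>u\<close> gives
  \<open>g v = g (tree_parent u)\<close>, and injectivity places \<open>v\<close> two levels above
  itself, which is absurd.\<close>

lemma auts_level_and_parent:
  assumes g: "g \<in> tree_auts k"
  shows "v \<in> tree_verts k \<Longrightarrow>
    fst (g v) = fst v \<and> (fst v \<noteq> 0 \<longrightarrow> g (tree_parent v) = tree_parent (g v))"
proof (induction "fst v" arbitrary: v rule: less_induct)
  case less
  show ?case
  proof (cases "fst v = 0")
    case True
    then have "v = tree_root"
      using less.prems by (cases v) (auto simp: in_tree_verts_iff tree_root_def)
    then show ?thesis
      using g by (simp add: tree_auts_def tree_root_def)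
  next
    case False
    define u where "u = tree_parent v"
    have uV: "u \<in> tree_verts k" and fu: "Suc (fst u) = fst v"
      using tree_parent_in_verts[OF less.prems False] False by (auto simp: u_def tree_parent_def)
    have gu: "fst (g u) = fst u" and gpu: "fst u \<noteq> 0 \<longrightarrow> g (tree_parent u) = tree_parent (g u)"
      using less.hyps[OF _ uV] fu by auto
    note V = auts_in_verts[OF g]
    have "tree_adj u v"
      using tree_child_iff[OF uV less.prems] False by (simp add: tree_adj_def u_def)
    then have "tree_adj (g u) (g v)"
      using g uV less.prems by (simp add: tree_auts_def)
    then consider "tree_child (g u) (g v)" | "tree_child (g v) (g u)"
      by (auto simp: tree_adj_def)
    then show ?thesis
    proof cases
      case 1
      then have "g u = tree_parent (g v)" "fst (g v) = Suc (fst (g u))"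
        using tree_child_iff[OF V[OF uV] V[OF less.prems]] by (blast, simp add: tree_child_def)
      then show ?thesis
        using gu fu by (simp add: u_def)
    next
      case 2
      then have *: "fst (g u) \<noteq> 0" "g v = tree_parent (g u)"
        using tree_child_iff[OF V[OF less.prems] V[OF uV]] by blast+
      then have "g v = g (tree_parent u)"
        using gpu gu by simp
      then have "v = tree_parent u"
        using inj_onD[OF auts_inj_on[OF g]] less.prems tree_parent_in_verts[OF uV] * gu by auto
      then show ?thesis
        using fu by (simp add: tree_parent_def)
    qed
  qed
qed

lemma auts_level: "g \<in> tree_auts k \<Longrightarrow> v \<in> tree_verts k \<Longrightarrow> fst (g v) = fst v"
  using auts_level_and_parent by blast

lemma auts_parent:
  "g \<in> tree_auts k \<Longrightarrow> v \<in> tree_verts k \<Longrightarrow> fst v \<noteq> 0 \<Longrightarrow> g (tree_parent v) = tree_parent (g v)"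
  using auts_level_and_parent by blast

text \<open>The criterion by which all automorphisms below are constructed. On a finite vertex set
  an injective self-map is bijective.\<close>

lemma tree_autsI:
  assumes ext: "g \<in> extensional (tree_verts k)" and inj: "inj_on g (tree_verts k)"
    and V: "\<And>v. v \<in> tree_verts k \<Longrightarrow> g v \<in> tree_verts k"
    and level: "\<And>v. v \<in> tree_verts k \<Longrightarrow> fst (g v) = fst v"
    and parent: "\<And>v. v \<in> tree_verts k \<Longrightarrow> fst v \<noteq> 0 \<Longrightarrow> g (tree_parent v) = tree_parent (g v)"
  shows "g \<in> tree_auts k"
proof -
  have "g ` tree_verts k = tree_verts k"
    by (rule endo_inj_surj[OF finite_tree_verts _ inj]) (use V in auto)
  then have "g \<in> Bij (tree_verts k)"
    using ext inj by (simp add: Bij_def bij_betw_def)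
  moreover have root: "tree_root \<in> tree_verts k"
    by (simp add: in_tree_verts_iff tree_root_def)
  have "g tree_root = tree_root"
    using V[OF root] level[OF root] by (cases "g tree_root") (auto simp: in_tree_verts_iff tree_root_def)
  \<comment> \<open>Adjacency is also reflected: \<open>g u = tree_parent (g v)\<close> means
    \<open>g u = g (tree_parent v)\<close>, and injectivity yields
    \<open>u = tree_parent v\<close>.\<close>
  moreover have "tree_child (g u) (g v) \<longleftrightarrow> tree_child u v"
    if u: "u \<in> tree_verts k" and v: "v \<in> tree_verts k" for u v
    using tree_child_iff[OF V[OF u] V[OF v]] tree_child_iff[OF u v] level[OF v] parent[OF v]
      inj_onD[OF inj _ u tree_parent_in_verts[OF v]] by auto
  ultimately show ?thesis
    by (simp add: tree_auts_def tree_adj_def)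
qed

section \<open>The automorphism group\<close>

lemma carrier_AutTree [simp]: "carrier (AutTree k) = tree_auts k"
  by (simp add: AutTree_def)

lemma mult_AutTree:
  "g \<in> tree_auts k \<Longrightarrow> h \<in> tree_auts k \<Longrightarrow> g \<otimes>\<^bsub>AutTree k\<^esub> h = compose (tree_verts k) g h"
  by (simp add: AutTree_def BijGroup_def auts_Bij)

lemma mult_AutTree_apply:
  assumes "g \<in> tree_auts k" "h \<in> tree_auts k" "v \<in> tree_verts k"
  shows "(g \<otimes>\<^bsub>AutTree k\<^esub> h) v = g (h v)"
  using assms by (simp add: mult_AutTree compose_def)

lemma one_AutTree: "\<one>\<^bsub>AutTree k\<^esub> = (\<lambda>v\<in>tree_verts k. v)"
  by (simp add: AutTree_def BijGroup_def)

lemma subgroup_tree_auts: "subgroup (tree_auts k) (BijGroup (tree_verts k))"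
proof (rule group.subgroupI[OF group_BijGroup])
  show "tree_auts k \<subseteq> carrier (BijGroup (tree_verts k))"
    by (auto simp: BijGroup_def auts_Bij)
  have "(\<lambda>v\<in>tree_verts k. v) \<in> tree_auts k"
    by (rule tree_autsI) (auto simp: inj_on_def tree_parent_in_verts)
  then show "tree_auts k \<noteq> {}" by blast
next
  fix g assume g: "g \<in> tree_auts k"
  let ?h = "inv_into (tree_verts k) g"
  have surj: "g ` tree_verts k = tree_verts k"
    using auts_Bij[OF g] by (simp add: Bij_def bij_betw_def)
  have hV: "?h v \<in> tree_verts k" if "v \<in> tree_verts k" for v
    using that surj by (metis inv_into_into)
  have gh: "g (?h v) = v" if "v \<in> tree_verts k" for v
    using that surj by (metis f_inv_into_f)
  have level: "fst (?h v) = fst v" if v: "v \<in> tree_verts k" for v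
    using auts_level[OF g hV[OF v]] gh[OF v] by simp
  have "(\<lambda>v\<in>tree_verts k. ?h v) \<in> tree_auts k"
  proof (rule tree_autsI)
    fix v assume v: "v \<in> tree_verts k" and nz: "fst v \<noteq> 0"
    \<comment> \<open>Undoing \<open>g\<close> on both sides turns its compatibility with parents
      into that of the inverse.\<close>
    have "g (tree_parent (?h v)) = tree_parent v"
      using auts_parent[OF g hV[OF v]] level[OF v] nz gh[OF v] by simp
    then have "?h (tree_parent v) = tree_parent (?h v)"
      using inv_into_f_f[OF auts_inj_on[OF g]] tree_parent_in_verts[OF hV[OF v]] level[OF v] nz
      by metis
    then show "(\<lambda>v\<in>tree_verts k. ?h v) (tree_parent v) = tree_parent ((\<lambda>v\<in>tree_verts k. ?h v) v)"
      using v nz tree_parent_in_verts by simp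
  next
    show "inj_on (\<lambda>v\<in>tree_verts k. ?h v) (tree_verts k)"
      by (rule inj_onI) (metis gh restrict_apply')
  qed (use hV level in auto)
  then show "inv\<^bsub>BijGroup (tree_verts k)\<^esub> g \<in> tree_auts k"
    by (simp add: inv_BijGroup auts_Bij g)
next
  fix g h assume g: "g \<in> tree_auts k" and h: "h \<in> tree_auts k"
  have "compose (tree_verts k) g h \<in> tree_auts k"
  proof (rule tree_autsI)
    show "compose (tree_verts k) g h \<in> extensional (tree_verts k)"
      by simp
    show "inj_on (compose (tree_verts k) g h) (tree_verts k)"
      using compose_Bij[OF auts_Bij[OF g] auts_Bij[OF h]] by (simp add: Bij_def bij_betw_def)
  qed (simp_all add: compose_def auts_in_verts[OF g] auts_in_verts[OF h] auts_level[OF g]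
      auts_level[OF h] auts_parent[OF g] auts_parent[OF h] tree_parent_in_verts)
  then show "g \<otimes>\<^bsub>BijGroup (tree_verts k)\<^esub> h \<in> tree_auts k"
    using g h by (simp add: BijGroup_def auts_Bij)
qed

lemma group_AutTree: "group (AutTree k)"
  unfolding AutTree_def by (rule subgroup.subgroup_is_group[OF subgroup_tree_auts group_BijGroup])

lemma finite_tree_auts: "finite (tree_auts k)"
proof (rule finite_subset)
  show "tree_auts k \<subseteq> (\<Pi>\<^sub>E v\<in>tree_verts k. tree_verts k)"
    by (auto simp: PiE_def intro: auts_in_verts Bij_imp_extensional[OF auts_Bij])
qed (simp add: finite_PiE finite_tree_verts)

lemma tree_auts_eqI:
  assumes "g \<in> tree_auts k" "h \<in> tree_auts k" "\<And>v. v \<in> tree_verts k \<Longrightarrow> g v = h v"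
  shows "g = h"
  using assms by (meson Bij_imp_extensional auts_Bij extensionalityI)

lemma inv_AutTree:
  assumes "g \<in> tree_auts k"
  shows "inv\<^bsub>AutTree k\<^esub> g \<in> tree_auts k"
    and "v \<in> tree_verts k \<Longrightarrow> (inv\<^bsub>AutTree k\<^esub> g) (g v) = v"
    and "v \<in> tree_verts k \<Longrightarrow> g ((inv\<^bsub>AutTree k\<^esub> g) v) = v"
proof -
  interpret group "AutTree k" by (rule group_AutTree)
  show I: "inv\<^bsub>AutTree k\<^esub> g \<in> tree_auts k"
    using inv_closed assms by simp
  show "(inv\<^bsub>AutTree k\<^esub> g) (g v) = v" if "v \<in> tree_verts k"
    using mult_AutTree_apply[OF I assms that] l_inv assms that by (simp add: one_AutTree)
  show "g ((inv\<^bsub>AutTree k\<^esub> g) v) = v" if "v \<in> tree_verts k"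
    using mult_AutTree_apply[OF assms I that] r_inv assms that by (simp add: one_AutTree)
qed

section \<open>Powers of two as orders of automorphisms and of subgroups\<close>

text \<open>An automorphism that fixes level \<open>j\<close> pointwise permutes the two children of each vertex
  there, so its square fixes level \<open>j + 1\<close> pointwise.\<close>
lemma auts_pow_fixes_level:
  assumes g: "g \<in> tree_auts k"
  shows "v \<in> tree_verts k \<Longrightarrow> fst v = j \<Longrightarrow> (g [^]\<^bsub>AutTree k\<^esub> (2 ^ j :: nat)) v = v"
proof (induction j arbitrary: v)
  interpret group "AutTree k" by (rule group_AutTree)
  {
    case 0
    then have "v = tree_root"
      by (cases v) (auto simp: in_tree_verts_iff tree_root_def)
    then show ?case
      using g by (simp add: tree_auts_def)
  next
    case (Suc j)
    define h where "h = g [^]\<^bsub>AutTree k\<^esub> (2 ^ j :: nat)"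
    have h: "h \<in> tree_auts k"
      using nat_pow_closed g by (simp add: h_def)
    have pow: "g [^]\<^bsub>AutTree k\<^esub> (2 ^ Suc j :: nat) = h \<otimes>\<^bsub>AutTree k\<^esub> h"
      using g by (simp add: h_def nat_pow_mult mult_2)
    have fix_parent: "tree_parent (h w) = tree_parent w" if "w \<in> tree_verts k" "fst w = Suc j" for w
    proof -
      have "h (tree_parent w) = tree_parent w"
        using Suc.IH[OF tree_parent_in_verts] that by (simp add: h_def tree_parent_def)
      then show ?thesis
        using auts_parent[OF h] that by simp
    qed
    have hv: "h v \<in> tree_verts k" "fst (h v) = Suc j"
      and hhv: "h (h v) \<in> tree_verts k" "fst (h (h v)) = Suc j"
      using Suc.prems auts_in_verts[OF h] auts_level[OF h] by auto
    have p: "tree_parent (h v) = tree_parent v" "tree_parent (h (h v)) = tree_parent v"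
      using fix_parent Suc.prems hv by auto
    \<comment> \<open>The vertices \<open>v\<close>, \<open>h v\<close> and \<open>h (h v)\<close>
      have the same parent, which has only two children. If \<open>h v\<close> differs from
      \<open>v\<close>, then \<open>h (h v)\<close> differs from \<open>h v\<close> and must be
      \<open>v\<close> again.\<close>
    have "h (h v) = v"
    proof (cases "h v = v")
      case False
      moreover have "h (h v) \<noteq> h v"
        using False inj_onD[OF auts_inj_on[OF h] _ hv(1) Suc.prems(1)] by auto
      ultimately show ?thesis
        using p hv hhv Suc.prems
        by (cases v; cases "h v"; cases "h (h v)") (simp add: tree_parent_def in_tree_verts_iff)
    qed simp
    then show ?case
      using pow mult_AutTree_apply[OF h h Suc.prems(1)] by simp
  }
qed

text \<open>A vertex \<open>v\<close> is fixed by the power with exponent \<open>2 ^ fst v\<close>,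
  and this exponent divides \<open>2 ^ k\<close>.\<close>

lemma auts_pow_eq_one:
  assumes g: "g \<in> tree_auts k"
  shows "g [^]\<^bsub>AutTree k\<^esub> (2 ^ k :: nat) = \<one>\<^bsub>AutTree k\<^esub>"
proof (rule tree_auts_eqI)
  interpret group "AutTree k" by (rule group_AutTree)
  show "g [^]\<^bsub>AutTree k\<^esub> (2 ^ k :: nat) \<in> tree_auts k" "\<one>\<^bsub>AutTree k\<^esub> \<in> tree_auts k"
    using nat_pow_closed one_closed g by auto
  fix v assume v: "v \<in> tree_verts k"
  define h where "h = g [^]\<^bsub>AutTree k\<^esub> (2 ^ fst v :: nat)"
  have h: "h \<in> tree_auts k"
    using nat_pow_closed g by (simp add: h_def)
  have "(h [^]\<^bsub>AutTree k\<^esub> n) v = v" for n :: nat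
  proof (induction n)
    case (Suc n)
    then show ?case
      using auts_pow_fixes_level[OF g v refl] mult_AutTree_apply[OF _ h v] nat_pow_closed[of h n] h
      by (simp add: h_def)
  qed (use v in \<open>simp add: one_AutTree\<close>)
  moreover have "g [^]\<^bsub>AutTree k\<^esub> (2 ^ k :: nat) = h [^]\<^bsub>AutTree k\<^esub> (2 ^ (k - fst v) :: nat)"
    using v g by (simp add: h_def nat_pow_pow in_tree_verts_iff flip: power_add)
  ultimately show "(g [^]\<^bsub>AutTree k\<^esub> (2 ^ k :: nat)) v = \<one>\<^bsub>AutTree k\<^esub> v"
    using v by (simp add: one_AutTree)
qed

text \<open>If the order had an odd part greater than 1, some odd prime \<open>q\<close> would
  divide it and there would be a subgroup of order \<open>q\<close>. The order of each of its
  elements divides both \<open>q\<close> and \<open>2 ^ n\<close>, so the subgroup would be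
  trivial.\<close>

lemma (in group) order_power_of_two_exponent:
  assumes fin: "finite (carrier G)"
    and exp: "\<And>x. x \<in> carrier G \<Longrightarrow> x [^] (2 ^ n :: nat) = \<one>"
  shows "\<exists>m. Coset.order G = 2 ^ m"
proof (rule ccontr)
  assume *: "\<not> ?thesis"
  have pos: "Coset.order G > 0"
    using fin order_gt_0_iff_finite by blast
  obtain q where q: "Factorial_Ring.prime q" "q dvd Coset.order G" "q \<noteq> 2"
  proof -
    obtain m r where r: "Coset.order G = 2 ^ m * r" "\<not> 2 dvd r"
      by (rule multiplicity_decompose'[of "Coset.order G" 2]) (use pos in auto)
    then have "r \<noteq> 1" using * by auto
    then obtain q where "Factorial_Ring.prime q" "q dvd r"
      using prime_factor_nat by blast
    then show ?thesis using that[of q] r by (cases "q = 2") auto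
  qed
  \<comment> \<open>Sylow's theorem with exponent 1, that is, Cauchy's theorem.\<close>
  have "\<exists>H. subgroup H G \<and> card H = q ^ 1"
  proof (rule sylow_thm[OF q(1) is_group _ fin])
    show "Coset.order G = q ^ 1 * (Coset.order G div q)" using q by simp
  qed
  then obtain H where H: "subgroup H G" "card H = q" by auto
  interpret H: group "G\<lparr>carrier := H\<rparr>"
    using subgroup_imp_group[OF H(1)] .
  have "H \<subseteq> {\<one>}"
  proof
    fix x assume x: "x \<in> H"
    then have xG: "x \<in> carrier G"
      using H(1) subgroup.mem_carrier by metis
    have "x [^] q = \<one>"
      using H.pow_order_eq_1[of x] x H(2) nat_pow_consistent[of x q H] by (simp add: Coset.order_def)
    then have "ord x dvd q" "ord x dvd 2 ^ n"
      using exp xG pow_eq_id by auto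
    moreover have "coprime q (2 ^ n)"
      using q primes_coprime[OF q(1) two_is_prime_nat] by simp
    ultimately have "ord x = 1"
      by (metis coprime_common_divisor nat_dvd_1_iff_1)
    then show "x \<in> {\<one>}"
      using pow_eq_id[OF xG, of 1] xG by simp
  qed
  then have "card H \<le> 1"
    using card_mono[of "{\<one>}" H] by simp
  then show False
    using H(2) prime_gt_1_nat[OF q(1)] by simp
qed

text \<open>A subgroup inherits the exponent bound \<open>2 ^ k\<close>, so its own order is a power
  of two.\<close>

lemma subgroup_AutTree_card:
  assumes "subgroup H (AutTree k)"
  shows "p_subgroup 2 H (AutTree k)"
proof -
  interpret A: group "AutTree k" by (rule group_AutTree)
  interpret H: group "AutTree k\<lparr>carrier := H\<rparr>"
    using A.subgroup_imp_group[OF assms] .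
  have sub: "H \<subseteq> tree_auts k"
    using subgroup.subset[OF assms] by simp
  have "\<exists>m. Coset.order (AutTree k\<lparr>carrier := H\<rparr>) = 2 ^ m"
  proof (rule H.order_power_of_two_exponent)
    show "finite (carrier (AutTree k\<lparr>carrier := H\<rparr>))"
      using finite_subset[OF sub finite_tree_auts] by simp
    fix x assume "x \<in> carrier (AutTree k\<lparr>carrier := H\<rparr>)"
    then show "x [^]\<^bsub>AutTree k\<lparr>carrier := H\<rparr>\<^esub> (2 ^ k :: nat) = \<one>\<^bsub>AutTree k\<lparr>carrier := H\<rparr>\<^esub>"
      using auts_pow_eq_one[of x k] sub A.nat_pow_consistent[of x "2 ^ k :: nat" H] by auto
  qed
  then show ?thesis
    using assms by (simp add: p_subgroup_def Coset.order_def)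
qed

section \<open>Parity on the last level\<close>

text \<open>An injective, level-preserving map permutes the finite last level.
  \<open>perm_restrict\<close> is there because \<open>permutes\<close> demands the identity off the
  set, whereas \<open>g\<close> may move vertices of other levels and is \<open>undefined\<close>
  outside the tree.\<close>

lemma auts_permutes_level:
  assumes "g \<in> tree_auts k"
  shows "perm_restrict g (tree_level k) permutes tree_level k"
proof -
  have inj: "inj_on g (tree_level k)"
    using auts_inj_on[OF assms] tree_level_subset[OF order_refl] inj_on_subset by blast
  have "g ` tree_level k \<subseteq> tree_level k"
    using auts_level[OF assms] auts_in_verts[OF assms] tree_level_subset[OF order_refl, of k]
    by (fastforce simp: in_tree_level_iff in_tree_verts_iff)
  then have "g ` tree_level k = tree_level k"
    by (rule endo_inj_surj[OF finite_tree_level _ inj])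
  then have "bij_betw (perm_restrict g (tree_level k)) (tree_level k) (tree_level k)"
    using inj by (auto simp: bij_betw_def perm_restrict_def inj_on_def image_def)
  then show ?thesis
    by (rule bij_imp_permutes) (simp add: perm_restrict_def)
qed

lemma auts_permutation_level:
  "g \<in> tree_auts k \<Longrightarrow> permutation (perm_restrict g (tree_level k))"
  using permutes_imp_permutation[OF finite_tree_level auts_permutes_level] .

text \<open>As \<open>h\<close> maps the last level to itself, restriction to that level respects
  products, and the sign is multiplicative.\<close>

lemma even_on_level_mult:
  assumes g: "g \<in> tree_auts k" and h: "h \<in> tree_auts k"
  shows "even_on_level k (g \<otimes>\<^bsub>AutTree k\<^esub> h) \<longleftrightarrow> (even_on_level k g = even_on_level k h)"
proof -
  have "h v \<in> tree_level k" if "v \<in> tree_level k" for v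
    using permutes_in_image[OF auts_permutes_level[OF h], of v] that by (simp add: perm_restrict_def)
  then have "perm_restrict (g \<otimes>\<^bsub>AutTree k\<^esub> h) (tree_level k)
      = perm_restrict g (tree_level k) \<circ> perm_restrict h (tree_level k)"
    using mult_AutTree_apply[OF g h] tree_level_subset[OF order_refl, of k]
    by (auto simp: fun_eq_iff perm_restrict_def)
  then show ?thesis
    by (simp add: even_on_level_def evenperm_comp auts_permutation_level g h)
qed

lemma even_on_level_one: "even_on_level k \<one>\<^bsub>AutTree k\<^esub>"
proof -
  have "perm_restrict \<one>\<^bsub>AutTree k\<^esub> (tree_level k) = id"
    using tree_level_subset[OF order_refl, of k]
    by (auto simp: fun_eq_iff perm_restrict_def one_AutTree)
  then show ?thesis
    by (simp add: even_on_level_def evenperm_id)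
qed

lemma even_on_level_inv:
  assumes g: "g \<in> tree_auts k"
  shows "even_on_level k (inv\<^bsub>AutTree k\<^esub> g) \<longleftrightarrow> even_on_level k g"
proof -
  interpret group "AutTree k" by (rule group_AutTree)
  show ?thesis
    using even_on_level_mult[OF g inv_AutTree(1)[OF g]] r_inv[of g] g even_on_level_one[of k]
    by auto
qed

text \<open>\<open>G_sub k\<close> is the kernel of the sign of the action on the last
  level.\<close>

lemma subgroup_G_sub: "subgroup (G_sub k) (AutTree k)"
proof (rule group.subgroupI[OF group_AutTree])
  interpret group "AutTree k" by (rule group_AutTree)
  show "G_sub k \<subseteq> carrier (AutTree k)"
    by (auto simp: G_sub_def)
  show "G_sub k \<noteq> {}"
    using even_on_level_one[of k] one_closed by (auto simp: G_sub_def)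
  show "inv\<^bsub>AutTree k\<^esub> g \<in> G_sub k" if "g \<in> G_sub k" for g
    using that by (simp add: G_sub_def even_on_level_inv inv_AutTree(1))
  show "g \<otimes>\<^bsub>AutTree k\<^esub> h \<in> G_sub k" if "g \<in> G_sub k" "h \<in> G_sub k" for g h
    using that m_closed[of g h] by (simp add: G_sub_def even_on_level_mult)
qed

section \<open>Active states\<close>

text \<open>The image of the left child of \<open>(j, i)\<close> is a child of
  \<open>g (j, i) = (j, m)\<close>, so its index is \<open>2 * m - 1\<close> or
  \<open>2 * m\<close>. The even one is the active case. States thereby become parities, which are
  easier to follow through products.\<close>

lemma active_iff:
  assumes g: "g \<in> tree_auts k" and "j < k" "i \<in> {1..2 ^ j}"
  shows "active g j i \<longleftrightarrow> even (snd (g (Suc j, 2 * i - 1)))"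
proof -
  have V: "(Suc j, 2 * i - 1) \<in> tree_verts k"
    using assms by (auto simp: in_tree_verts_iff)
  obtain n where n: "g (Suc j, 2 * i - 1) = (Suc j, n)"
    using auts_level[OF g V] by (metis prod.collapse fst_conv)
  have p: "tree_parent (Suc j, 2 * i - 1) = (j, i)"
    using assms by (auto simp: tree_parent_def)
  have "g (j, i) = (j, (n + 1) div 2)"
    using auts_parent[OF g V] unfolding p n by (simp add: tree_parent_def)
  then show ?thesis
    unfolding active_def n by (auto elim!: evenE) presburger
qed

text \<open>With trivial states on level \<open>j\<close>, left children go to left children, which
  have odd indices. The right sibling then goes to the remaining child of the same vertex, whose
  index is even.\<close>

lemma no_active_imp_parity:
  assumes g: "g \<in> tree_auts k" and j: "j < k"
    and na: "\<And>i. i \<in> {1..2 ^ j} \<Longrightarrow> \<not> active g j i"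
    and v: "v \<in> tree_verts k" "fst v = Suc j"
  shows "even (snd (g v)) \<longleftrightarrow> even (snd v)"
proof -
  define i where "i = (snd v + 1) div 2"
  have i: "i \<in> {1..2 ^ j}"
    using v by (auto simp: i_def in_tree_verts_iff)
  \<comment> \<open>The left child of the parent of \<open>v\<close>: either \<open>v\<close> itself
    or its sibling.\<close>
  define u where "u = (Suc j, 2 * i - 1)"
  have u: "u \<in> tree_verts k"
    using i j by (auto simp: u_def in_tree_verts_iff)
  have odd_gu: "odd (snd (g u))"
    using na[OF i] active_iff[OF g j i] by (simp add: u_def)
  show ?thesis
  proof (cases "odd (snd v)")
    case True
    then have "v = u"
      using v by (cases v) (auto simp: u_def i_def elim!: oddE)
    then show ?thesis
      using odd_gu True by simp
  next
    case False
    then have "v \<noteq> u"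
      using i by (auto simp: u_def)
    then have ne: "g v \<noteq> g u"
      using inj_onD[OF auts_inj_on[OF g] _ v(1) u] by blast
    have "tree_parent u = tree_parent v"
      using i v by (auto simp: u_def i_def tree_parent_def)
    then have "tree_parent (g u) = tree_parent (g v)"
      using auts_parent[OF g u] auts_parent[OF g v(1)] v(2) by (simp add: u_def)
    moreover have "fst (g u) = fst (g v)"
      using auts_level[OF g u] auts_level[OF g v(1)] v(2) by (simp add: u_def)
    ultimately have "even (snd (g v))"
      using ne odd_gu by (cases "g u"; cases "g v") (auto simp: tree_parent_def; presburger)
    then show ?thesis
      using False by simp
  qed
qed

text \<open>For \<open>j < k\<close> the bound \<open>j + 2 \<le> k\<close> fails only at
  \<open>j = k - 1\<close>, so membership just says that all states on level \<open>k - 1\<close>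
  are trivial. In terms of parity this property visibly passes to products and inverses.\<close>

lemma B_sub_iff:
  assumes k: "k \<ge> 1"
  shows "g \<in> B_sub k \<longleftrightarrow>
    g \<in> tree_auts k \<and> (\<forall>v\<in>tree_level k. even (snd (g v)) \<longleftrightarrow> even (snd v))"
proof
  obtain j where j: "k = Suc j"
    using k by (cases k) auto
  {
    assume g: "g \<in> B_sub k"
    have "even (snd (g v)) \<longleftrightarrow> even (snd v)" if "v \<in> tree_level k" for v
      by (rule no_active_imp_parity[of g k j])
        (use g that in \<open>auto simp: B_sub_def j in_tree_verts_iff in_tree_level_iff\<close>)
    then show "g \<in> tree_auts k \<and> (\<forall>v\<in>tree_level k. even (snd (g v)) \<longleftrightarrow> even (snd v))"
      using g by (simp add: B_sub_def)
  next
    assume "g \<in> tree_auts k \<and> (\<forall>v\<in>tree_level k. even (snd (g v)) \<longleftrightarrow> even (snd v))"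
    then have g: "g \<in> tree_auts k" and par: "\<forall>v\<in>tree_level k. even (snd (g v)) \<longleftrightarrow> even (snd v)"
      by auto
    have "\<not> active g j i" if "i \<in> {1..2 ^ j}" for i
    proof -
      have "(Suc j, 2 * i - 1) \<in> tree_level k"
        using that by (auto simp: j in_tree_level_iff)
      then show ?thesis
        using active_iff[OF g _ that] par that by (auto simp: j)
    qed
    then have "i + 2 \<le> k" if "i < k" "m \<in> {1..2 ^ i}" "active g i m" for i m
      using that by (cases "i = j") (auto simp: j)
    then show "g \<in> B_sub k"
      using g by (auto simp: B_sub_def)
  }
qed

text \<open>Trivial states on the levels before \<open>k - 1\<close> fix everything above level
  \<open>k\<close>, by induction: once the parent is fixed, the parity of the index determines the
  child. Conversely, a fixed left child keeps its odd index, so the state of its parent is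
  trivial.\<close>

lemma W_sub_iff:
  "g \<in> W_sub k \<longleftrightarrow> g \<in> G_sub k \<and> (\<forall>v\<in>tree_verts k. fst v < k \<longrightarrow> g v = v)"
proof (intro iffI conjI ballI impI; (elim conjE)?)
  fix v assume gW: "g \<in> W_sub k" and "v \<in> tree_verts k" "fst v < k"
  then have g: "g \<in> tree_auts k"
    by (simp add: W_sub_def G_sub_def)
  from \<open>v \<in> tree_verts k\<close> \<open>fst v < k\<close> show "g v = v"
  proof (induction "fst v" arbitrary: v)
    case 0
    then have "v = tree_root"
      by (cases v) (auto simp: in_tree_verts_iff tree_root_def)
    then show ?case
      using g by (simp add: tree_auts_def)
  next
    case (Suc j)
    have fv: "fst v = Suc j"
      using Suc.hyps(2) by simp
    \<comment> \<open>The relevant states sit on the level of the parent. As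
      \<open>Suc j < k\<close>, that level is not \<open>k - 1\<close>.\<close>
    have "\<not> active g j i" if "i \<in> {1..2 ^ j}" for i
    proof
      assume "active g j i"
      moreover have "j < k"
        using fv Suc.prems(2) by simp
      ultimately have "j + 1 = k"
        using gW that unfolding W_sub_def by blast
      then show False
        using fv Suc.prems(2) by simp
    qed
    then have "even (snd (g v)) \<longleftrightarrow> even (snd v)"
      using no_active_imp_parity[OF g _ _ Suc.prems(1) fv] fv Suc.prems(2) by simp
    moreover have "g (tree_parent v) = tree_parent v"
      by (rule Suc.hyps(1)[OF _ tree_parent_in_verts])
        (use fv Suc.prems in \<open>auto simp: tree_parent_def\<close>)
    then have "tree_parent (g v) = tree_parent v"
      using auts_parent[OF g Suc.prems(1)] fv by simp
    moreover have "fst (g v) = fst v"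
      by (rule auts_level[OF g Suc.prems(1)])
    ultimately show ?case
      by (cases v; cases "g v") (auto simp: tree_parent_def; presburger)
  qed
next
  assume gG: "g \<in> G_sub k" and low: "\<forall>v\<in>tree_verts k. fst v < k \<longrightarrow> g v = v"
  have g: "g \<in> tree_auts k"
    using gG by (simp add: G_sub_def)
  have "j + 1 = k" if "j < k" "i \<in> {1..2 ^ j}" "active g j i" for j i
  proof (rule ccontr)
    assume "j + 1 \<noteq> k"
    moreover have "(Suc j, 2 * i - 1) \<in> tree_verts k"
      using that by (auto simp: in_tree_verts_iff)
    ultimately have "g (Suc j, 2 * i - 1) = (Suc j, 2 * i - 1)"
      using low that(1) by simp
    then show False
      using active_iff[OF g that(1,2)] that by auto
  qed
  then show "g \<in> W_sub k"
    using gG unfolding W_sub_def by blast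
qed (simp add: W_sub_def)

section \<open>Evenness of the elements of \<open>B_sub k\<close>\<close>

text \<open>An element of \<open>B\<^sub>k\<^sub>-\<^sub>1\<close> acts in the same way on the odd and on the even vertices of
  the last level, so it acts as a product of two conjugate permutations.\<close>
lemma B_sub_even:
  assumes k: "k \<ge> 1" and gB: "g \<in> B_sub k"
  shows "even_on_level k g"
proof -
  have g: "g \<in> tree_auts k" and par: "\<And>v. v \<in> tree_level k \<Longrightarrow> even (snd (g v)) \<longleftrightarrow> even (snd v)"
    using gB B_sub_iff[OF k] by auto
  define A where "A = {v \<in> tree_level k. odd (snd v)}"
  define C where "C = {v \<in> tree_level k. even (snd v)}"
  \<comment> \<open>The involution that swaps the two children of every vertex on level
    \<open>k - 1\<close> and is the identity elsewhere. It interchanges \<open>A\<close> and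
    \<open>C\<close>.\<close>
  define s where "s v = (if v \<in> tree_level k then (fst v, if odd (snd v) then snd v + 1 else snd v - 1) else v)"
    for v :: "nat \<times> nat"
  let ?P = "perm_restrict g (tree_level k)"
  let ?p = "perm_restrict g A" and ?q = "perm_restrict g C"
  have level_eq: "tree_level k = A \<union> C" "A \<inter> C = {}"
    by (auto simp: A_def C_def)
  have P: "?P permutes tree_level k"
    by (rule auts_permutes_level[OF g])
  have glevel: "g v \<in> tree_level k" if "v \<in> tree_level k" for v
    using permutes_in_image[OF P, of v] that by (simp add: perm_restrict_def)
  have ginj: "inj_on g (tree_level k)"
    using auts_inj_on[OF g] tree_level_subset[OF order_refl] inj_on_subset by blast
  have restrict_permutes: "perm_restrict g D permutes D"
    if "D \<subseteq> tree_level k" "\<And>v. v \<in> D \<Longrightarrow> g v \<in> D" for D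
  proof (rule bij_imp_permutes)
    have inj: "inj_on g D"
      using ginj that(1) inj_on_subset by blast
    have "g ` D = D"
      by (rule endo_inj_surj[OF finite_subset[OF that(1) finite_tree_level] _ inj]) (use that in auto)
    then show "bij_betw (perm_restrict g D) D D"
      using inj by (auto simp: bij_betw_def perm_restrict_def inj_on_def image_def)
  qed (simp add: perm_restrict_def)
  have p: "?p permutes A"
    by (rule restrict_permutes) (auto simp: A_def par glevel)
  have q: "?q permutes C"
    by (rule restrict_permutes) (auto simp: C_def par glevel)
  have perm_p: "permutation ?p" and perm_q: "permutation ?q"
    using p q permutes_imp_permutation finite_tree_level level_eq(1) by (metis finite_Un)+
  have P_eq: "?P = ?p \<circ> ?q"
    using perm_restrict_union[OF p q level_eq(2)] level_eq(1) by simp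
  have s_level: "s v \<in> tree_level k" if "v \<in> tree_level k" for v
  proof -
    \<comment> \<open>The last index \<open>2 ^ k\<close> is even, so an odd index always has its
      right neighbour on the level.\<close>
    have "even (2 ^ k :: nat)" using k by simp
    then have "snd v + 1 \<le> 2 ^ k" if "odd (snd v)" "snd v \<le> 2 ^ k"
      using that by (metis Suc_eq_plus1 Suc_leI le_neq_implies_less)
    then show ?thesis
      using that by (cases v) (auto simp: s_def in_tree_level_iff)
  qed
  have ss: "s (s v) = v" for v
    using s_level[of v] by (cases v) (auto simp: s_def in_tree_level_iff)
  have s_perm: "s permutes tree_level k"
  proof (rule bij_imp_permutes)
    show "bij_betw s (tree_level k) (tree_level k)"
      by (rule bij_betw_byWitness[where f' = s]) (use ss s_level in auto)
  qed (simp add: s_def)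
  then have perm_s: "permutation s"
    using permutes_imp_permutation finite_tree_level by blast
  \<comment> \<open>Both sides are children of the same vertex, and their indices have the same
    parity because \<open>g\<close> preserves parity while \<open>s\<close> reverses it.\<close>
  have gs: "g (s v) = s (g v)" if v: "v \<in> tree_level k" for v
  proof -
    have V: "v \<in> tree_verts k" "s v \<in> tree_verts k" and f: "fst v = k" "fst (s v) = k"
      using v s_level[OF v] tree_level_subset[OF order_refl, of k] by (auto simp: in_tree_level_iff)
    have "tree_parent (s v) = tree_parent v"
      using v by (cases v) (auto simp: s_def in_tree_level_iff tree_parent_def elim!: oddE evenE)
    then have "tree_parent (g (s v)) = tree_parent (g v)"
      using auts_parent[OF g V(1)] auts_parent[OF g V(2)] f k by simp
    moreover have "tree_parent (s (g v)) = tree_parent (g v)"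
      using glevel[OF v]
      by (cases "g v") (auto simp: s_def in_tree_level_iff tree_parent_def elim!: oddE evenE)
    ultimately have "tree_parent (g (s v)) = tree_parent (s (g v))"
      by simp
    moreover have "even (snd (s w)) \<longleftrightarrow> odd (snd w)" if "w \<in> tree_level k" for w
      using that by (cases w) (auto simp: s_def in_tree_level_iff)
    then have "even (snd (g (s v))) \<longleftrightarrow> even (snd (s (g v)))"
      using par[OF s_level[OF v]] par[OF v] glevel[OF v] v by auto
    moreover have "fst (g (s v)) = fst (s (g v))"
      using glevel[OF v] glevel[OF s_level[OF v]] s_level[OF glevel[OF v]]
      by (simp add: in_tree_level_iff)
    ultimately show ?thesis
      by (cases "g (s v)"; cases "s (g v)") (auto simp: tree_parent_def; presburger)
  qed
  have s_swap: "s v \<in> A \<longleftrightarrow> v \<in> C" for v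
    using s_level[of v] by (cases v) (auto simp: A_def C_def s_def in_tree_level_iff)
  \<comment> \<open>Conjugation by the involution \<open>s\<close> carries the action on
    \<open>A\<close> to the action on \<open>C\<close>, since \<open>g\<close> commutes with
    \<open>s\<close>. The two factors of \<open>?P\<close> therefore have equal sign.\<close>
  have "?q = s \<circ> ?p \<circ> s"
  proof
    fix v
    show "?q v = (s \<circ> ?p \<circ> s) v"
      using s_swap[of v] gs[of v] ss level_eq(1) by (auto simp: perm_restrict_def)
  qed
  then have "evenperm ?q = evenperm ?p"
    using perm_s perm_p by (auto simp: evenperm_comp permutation_compose)
  then show ?thesis
    unfolding even_on_level_def P_eq using perm_p perm_q by (simp add: evenperm_comp)
qed

section \<open>The decomposition\<close>

lemma subgroup_B_sub:
  assumes k: "k \<ge> 1"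
  shows "subgroup (B_sub k) (AutTree k)"
proof (rule group.subgroupI[OF group_AutTree])
  interpret group "AutTree k" by (rule group_AutTree)
  note lV = subsetD[OF tree_level_subset[OF order_refl, of k]]
  have mem: "g v \<in> tree_level k" if "g \<in> tree_auts k" "v \<in> tree_level k" for g v
    using permutes_in_image[OF auts_permutes_level[OF that(1)], of v] that(2)
    by (simp add: perm_restrict_def)
  show "B_sub k \<subseteq> carrier (AutTree k)"
    by (auto simp: B_sub_def)
  have "\<one>\<^bsub>AutTree k\<^esub> \<in> B_sub k"
    using one_closed lV by (auto simp: B_sub_iff[OF k] one_AutTree)
  then show "B_sub k \<noteq> {}" by blast
  show "inv\<^bsub>AutTree k\<^esub> g \<in> B_sub k" if "g \<in> B_sub k" for g
  proof -
    have g: "g \<in> tree_auts k" and par: "\<And>v. v \<in> tree_level k \<Longrightarrow> even (snd (g v)) \<longleftrightarrow> even (snd v)"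
      using that B_sub_iff[OF k] by auto
    have "even (snd ((inv\<^bsub>AutTree k\<^esub> g) v)) \<longleftrightarrow> even (snd v)" if "v \<in> tree_level k" for v
      using par[OF mem[OF inv_AutTree(1)[OF g] that]] inv_AutTree(3)[OF g lV[OF that]] by simp
    then show ?thesis
      using inv_AutTree(1)[OF g] by (simp add: B_sub_iff[OF k])
  qed
  show "g \<otimes>\<^bsub>AutTree k\<^esub> h \<in> B_sub k" if gB: "g \<in> B_sub k" and hB: "h \<in> B_sub k" for g h
  proof -
    have g: "g \<in> tree_auts k" and h: "h \<in> tree_auts k"
      using gB hB B_sub_iff[OF k] by auto
    have "even (snd ((g \<otimes>\<^bsub>AutTree k\<^esub> h) v)) \<longleftrightarrow> even (snd v)" if "v \<in> tree_level k" for v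
      using gB hB mem[OF h that] that mult_AutTree_apply[OF g h lV[OF that]]
      by (simp add: B_sub_iff[OF k])
    then show ?thesis
      using m_closed[of g h] g h by (simp add: B_sub_iff[OF k])
  qed
qed

text \<open>By \<open>W_sub_iff\<close>, this is the intersection of \<open>G_sub k\<close> with the
  pointwise stabiliser of all levels above the last.\<close>

lemma subgroup_W_sub: "subgroup (W_sub k) (AutTree k)"
proof (rule group.subgroupI[OF group_AutTree])
  interpret group "AutTree k" by (rule group_AutTree)
  show "W_sub k \<subseteq> carrier (AutTree k)"
    by (auto simp: W_sub_def G_sub_def)
  have "\<one>\<^bsub>AutTree k\<^esub> \<in> W_sub k"
    using subgroup.one_closed[OF subgroup_G_sub] by (simp add: W_sub_iff one_AutTree)
  then show "W_sub k \<noteq> {}" by blast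
  show "inv\<^bsub>AutTree k\<^esub> g \<in> W_sub k" if "g \<in> W_sub k" for g
  proof -
    have g: "g \<in> tree_auts k" and gG: "g \<in> G_sub k"
      using that by (auto simp: W_sub_def G_sub_def)
    have "(inv\<^bsub>AutTree k\<^esub> g) v = v" if v: "v \<in> tree_verts k" "fst v < k" for v
    proof -
      have "g v = v"
        using \<open>g \<in> W_sub k\<close> v by (simp add: W_sub_iff)
      then show ?thesis
        using inv_AutTree(2)[OF g v(1)] by simp
    qed
    then show ?thesis
      using subgroup.m_inv_closed[OF subgroup_G_sub gG] by (simp add: W_sub_iff)
  qed
  show "g \<otimes>\<^bsub>AutTree k\<^esub> h \<in> W_sub k" if "g \<in> W_sub k" "h \<in> W_sub k" for g h
    using that subgroup.m_closed[OF subgroup_G_sub, of g k h] mult_AutTree_apply[of g k h]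
    by (simp add: W_sub_iff G_sub_def)
qed

text \<open>The inverse of \<open>g\<close> keeps levels, so it sends a vertex above level
  \<open>k\<close> to one that \<open>w\<close> fixes, and \<open>g\<close> brings it back. This
  serves both normality in \<open>G_sub k\<close> and the action of \<open>B_sub k\<close>.\<close>

lemma W_sub_conj_closed:
  assumes gG: "g \<in> G_sub k" and w: "w \<in> W_sub k"
  shows "g \<otimes>\<^bsub>AutTree k\<^esub> w \<otimes>\<^bsub>AutTree k\<^esub> inv\<^bsub>AutTree k\<^esub> g \<in> W_sub k"
proof -
  interpret group "AutTree k" by (rule group_AutTree)
  have g: "g \<in> tree_auts k" and w': "w \<in> tree_auts k" and wG: "w \<in> G_sub k"
    using gG w by (auto simp: G_sub_def W_sub_def)
  note i = inv_AutTree[OF g]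
  have gw: "g \<otimes>\<^bsub>AutTree k\<^esub> w \<in> tree_auts k"
    using m_closed[of g w] g w' by simp
  have "g \<otimes>\<^bsub>AutTree k\<^esub> w \<otimes>\<^bsub>AutTree k\<^esub> inv\<^bsub>AutTree k\<^esub> g \<in> G_sub k"
    using gG wG by (intro subgroup.m_closed[OF subgroup_G_sub] subgroup.m_inv_closed[OF subgroup_G_sub])
  moreover have "(g \<otimes>\<^bsub>AutTree k\<^esub> w \<otimes>\<^bsub>AutTree k\<^esub> inv\<^bsub>AutTree k\<^esub> g) v = v"
    if v: "v \<in> tree_verts k" "fst v < k" for v
  proof -
    let ?u = "(inv\<^bsub>AutTree k\<^esub> g) v"
    have u: "?u \<in> tree_verts k" "fst ?u < k"
      using auts_in_verts[OF i(1) v(1)] auts_level[OF i(1) v(1)] v(2) by auto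
    then have "w ?u = ?u"
      using w by (simp add: W_sub_iff)
    then show ?thesis
      using mult_AutTree_apply[OF gw i(1) v(1)] mult_AutTree_apply[OF g w' u(1)] i(3)[OF v(1)]
      by simp
  qed
  ultimately show ?thesis
    by (simp add: W_sub_iff)
qed

text \<open>A vertex on the last level has a fixed parent by membership in \<open>W_sub k\<close>.
  Its image is thus a child of the same vertex, and the parity preserved by \<open>B_sub k\<close>
  decides which one.\<close>

lemma B_inter_W:
  assumes k: "k \<ge> 1"
  shows "B_sub k \<inter> W_sub k = {\<one>\<^bsub>AutTree k\<^esub>}"
proof -
  have "g = \<one>\<^bsub>AutTree k\<^esub>" if gB: "g \<in> B_sub k" and gW: "g \<in> W_sub k" for g
  proof (rule tree_auts_eqI)
    show g: "g \<in> tree_auts k"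
      using gB by (simp add: B_sub_def)
    show "\<one>\<^bsub>AutTree k\<^esub> \<in> tree_auts k"
      using monoid.one_closed[OF group.is_monoid[OF group_AutTree[of k]]] by simp
    fix v assume v: "v \<in> tree_verts k"
    have fixed: "g u = u" if "u \<in> tree_verts k" "fst u < k" for u
      using gW that by (simp add: W_sub_iff)
    have "g v = v"
    proof (cases "fst v < k")
      case False
      then have fv: "fst v = k" using v by (simp add: in_tree_verts_iff)
      then have "v \<in> tree_level k"
        using v by (simp add: in_tree_verts_iff in_tree_level_iff)
      then have "even (snd (g v)) \<longleftrightarrow> even (snd v)"
        using gB B_sub_iff[OF k] by auto
      moreover have "g (tree_parent v) = tree_parent v"
        by (rule fixed[OF tree_parent_in_verts[OF v]]) (use fv k in \<open>auto simp: tree_parent_def\<close>)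
      then have "tree_parent (g v) = tree_parent v"
        using auts_parent[OF g v] fv k by simp
      moreover have "fst (g v) = fst v"
        by (rule auts_level[OF g v])
      ultimately show ?thesis
        by (cases v; cases "g v") (auto simp: tree_parent_def; presburger)
    qed (use v fixed in simp)
    then show "g v = \<one>\<^bsub>AutTree k\<^esub> v"
      using v by (simp add: one_AutTree)
  qed
  then show ?thesis
    using subgroup.one_closed[OF subgroup_B_sub[OF k]] subgroup.one_closed[OF subgroup_W_sub[of k]]
    by blast
qed

section \<open>Existence of the factorization\<close>

text \<open>Keep the action of \<open>g\<close> above level \<open>k\<close> and make all states on
  level \<open>k - 1\<close> trivial.\<close>

lemma B_sub_agreeing_below:
  assumes k: "k \<ge> 1" and g: "g \<in> tree_auts k"
  shows "\<exists>b\<in>B_sub k. \<forall>v\<in>tree_verts k. fst v < k \<longrightarrow> b v = g v"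
proof -
  \<comment> \<open>The child of \<open>g (tree_parent v)\<close> on the same side, left or right,
    as \<open>v\<close> is below its own parent.\<close>
  define c where "c v = (let m = snd (g (tree_parent v)) in (k, if odd (snd v) then 2 * m - 1 else 2 * m))"
    for v :: "nat \<times> nat"
  define b where "b = (\<lambda>v\<in>tree_verts k. if fst v < k then g v else c v)"
  have c: "c v \<in> tree_level k" "tree_parent (c v) = g (tree_parent v)"
    "even (snd (c v)) \<longleftrightarrow> even (snd v)" if v: "v \<in> tree_verts k" "fst v = k" for v
  proof -
    have pV: "tree_parent v \<in> tree_verts k" and fp: "fst (tree_parent v) = k - 1"
      using tree_parent_in_verts[OF v(1)] v(2) k by (auto simp: tree_parent_def)
    define m where "m = snd (g (tree_parent v))"
    have gp: "g (tree_parent v) = (k - 1, m)"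
      using auts_level[OF g pV] fp by (simp add: m_def prod_eq_iff)
    have m: "1 \<le> m" "m \<le> 2 ^ (k - 1)"
      using auts_in_verts[OF g pV] by (auto simp: gp in_tree_verts_iff)
    have c_eq: "c v = (k, if odd (snd v) then 2 * m - 1 else 2 * m)"
      by (simp add: c_def gp)
    \<comment> \<open>This turns \<open>m \<le> 2 ^ (k - 1)\<close> into the bound on the child
      index \<open>2 * m\<close>.\<close>
    have "(2::nat) ^ k = 2 * 2 ^ (k - 1)"
      using k by (metis Suc_le_D diff_Suc_1 One_nat_def power_Suc)
    then show "c v \<in> tree_level k"
      using m by (auto simp: c_eq in_tree_level_iff)
    show "tree_parent (c v) = g (tree_parent v)"
      unfolding gp using m by (auto simp: c_eq tree_parent_def)
    show "even (snd (c v)) \<longleftrightarrow> even (snd v)"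
      using m by (auto simp: c_eq)
  qed
  have b_low: "b v = g v" if "v \<in> tree_verts k" "fst v < k" for v
    using that by (simp add: b_def)
  have b_top: "b v = c v" if "v \<in> tree_verts k" "fst v = k" for v
    using that by (simp add: b_def)
  have cases: "fst v < k \<or> fst v = k" if "v \<in> tree_verts k" for v
    using that by (auto simp: in_tree_verts_iff)
  have b_level: "fst (b v) = fst v" if "v \<in> tree_verts k" for v
    using cases[OF that] b_low[OF that] b_top[OF that] c(1)[OF that] auts_level[OF g that]
    by (auto simp: in_tree_level_iff)
  have b_verts: "b v \<in> tree_verts k" if "v \<in> tree_verts k" for v
    using cases[OF that] b_low[OF that] b_top[OF that] c(1)[OF that] auts_in_verts[OF g that]
      tree_level_subset[OF order_refl, of k]
    by auto
  have b_parent: "b (tree_parent v) = tree_parent (b v)" if v: "v \<in> tree_verts k" "fst v \<noteq> 0" for v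
  proof -
    have "b (tree_parent v) = g (tree_parent v)"
      by (rule b_low[OF tree_parent_in_verts[OF v]])
        (use v in \<open>auto simp: tree_parent_def in_tree_verts_iff\<close>)
    then show ?thesis
      using cases[OF v(1)] b_low[OF v(1)] b_top[OF v(1)] c(2)[OF v(1)] auts_parent[OF g v] by auto
  qed
  have b_inj: "inj_on b (tree_verts k)"
  proof (rule inj_onI)
    fix u v assume u: "u \<in> tree_verts k" and v: "v \<in> tree_verts k" and eq: "b u = b v"
    have f: "fst u = fst v"
      using b_level[OF u] b_level[OF v] eq by simp
    show "u = v"
    proof (cases "fst v < k")
      case True
      then show ?thesis
        using eq b_low[OF u] b_low[OF v] f inj_onD[OF auts_inj_on[OF g] _ u v] by simp
    next
      case False
      then have fk: "fst u = k" "fst v = k"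
        using f cases[OF v] by auto
      \<comment> \<open>The parent of this common value determines the parents of \<open>u\<close>
        and \<open>v\<close>, by injectivity of \<open>g\<close>. Its parity determines which child
        each of them is.\<close>
      then have ceq: "c u = c v"
        using eq b_top[OF u] b_top[OF v] by simp
      then have "g (tree_parent u) = g (tree_parent v)"
        using c(2)[OF u fk(1)] c(2)[OF v fk(2)] by simp
      then have "tree_parent u = tree_parent v"
        using inj_onD[OF auts_inj_on[OF g]] tree_parent_in_verts u v fk k by simp
      moreover have "even (snd u) \<longleftrightarrow> even (snd v)"
        using c(3)[OF u fk(1)] c(3)[OF v fk(2)] ceq by simp
      ultimately show ?thesis
        using f by (cases u; cases v) (auto simp: tree_parent_def; presburger)
    qed
  qed
  have b_ext: "b \<in> extensional (tree_verts k)"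
    unfolding b_def by (rule restrict_extensional)
  have "b \<in> tree_auts k"
    by (rule tree_autsI[OF b_ext b_inj b_verts b_level b_parent]) simp_all
  moreover have "even (snd (b v)) \<longleftrightarrow> even (snd v)" if "v \<in> tree_level k" for v
  proof -
    have "v \<in> tree_verts k" "fst v = k"
      using that by (auto simp: in_tree_level_iff in_tree_verts_iff)
    then show ?thesis
      using b_top c(3) by simp
  qed
  ultimately have "b \<in> B_sub k"
    by (simp add: B_sub_iff[OF k])
  then show ?thesis
    using b_low by blast
qed

lemma B_sub_subset_G_sub: "k \<ge> 1 \<Longrightarrow> B_sub k \<subseteq> G_sub k"
  using B_sub_even by (auto simp: G_sub_def B_sub_def)

text \<open>Once \<open>b\<close> is chosen, the other factor must be \<open>b^-1 g\<close>. It is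
  even because \<open>b\<close> and \<open>g\<close> are, and it fixes the levels on which they
  agree.\<close>

lemma G_sub_factorization:
  assumes k: "k \<ge> 1" and gG: "g \<in> G_sub k"
  shows "\<exists>b\<in>B_sub k. \<exists>w\<in>W_sub k. g = b \<otimes>\<^bsub>AutTree k\<^esub> w"
proof -
  interpret group "AutTree k" by (rule group_AutTree)
  have g: "g \<in> tree_auts k"
    using gG by (simp add: G_sub_def)
  obtain b where bB: "b \<in> B_sub k" and eq: "\<And>v. v \<in> tree_verts k \<Longrightarrow> fst v < k \<Longrightarrow> b v = g v"
    using B_sub_agreeing_below[OF k g] by blast
  then have b: "b \<in> tree_auts k" and bG: "b \<in> G_sub k"
    using B_sub_subset_G_sub[OF k] by (auto simp: B_sub_def)
  define w where "w = inv\<^bsub>AutTree k\<^esub> b \<otimes>\<^bsub>AutTree k\<^esub> g"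
  have "w \<in> G_sub k"
    unfolding w_def
    using gG bG by (intro subgroup.m_closed[OF subgroup_G_sub] subgroup.m_inv_closed[OF subgroup_G_sub])
  moreover have "w v = v" if v: "v \<in> tree_verts k" "fst v < k" for v
    using mult_AutTree_apply[OF inv_AutTree(1)[OF b] g v(1)] eq[OF v] inv_AutTree(2)[OF b v(1)]
    by (simp add: w_def)
  ultimately have "w \<in> W_sub k"
    by (simp add: W_sub_iff)
  moreover have "g = b \<otimes>\<^bsub>AutTree k\<^esub> w"
    using b g by (simp add: w_def inv_AutTree(1) flip: m_assoc)
  ultimately show ?thesis
    using bB by blast
qed

lemma inner_semidirect_G_sub:
  assumes k: "k \<ge> 1"
  shows "inner_semidirect (AutTree k\<lparr>carrier := G_sub k\<rparr>) (B_sub k) (W_sub k)"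
proof -
  interpret A: group "AutTree k" by (rule group_AutTree)
  interpret G: group "AutTree k\<lparr>carrier := G_sub k\<rparr>"
    by (rule A.subgroup_imp_group[OF subgroup_G_sub])
  note BG = B_sub_subset_G_sub[OF k]
  have WG: "W_sub k \<subseteq> G_sub k"
    by (auto simp: W_sub_def)
  have B: "subgroup (B_sub k) (AutTree k\<lparr>carrier := G_sub k\<rparr>)"
    using A.subgroup_incl[OF subgroup_B_sub[OF k] subgroup_G_sub BG] .
  have "W_sub k \<lhd> AutTree k\<lparr>carrier := G_sub k\<rparr>"
    \<comment> \<open>Normality is meant inside \<open>G_sub k\<close>. Inverses taken there
      coincide with those in the whole automorphism group, where closure under conjugation was
      shown.\<close>
    unfolding G.normal_inv_iff
    using A.subgroup_incl[OF subgroup_W_sub subgroup_G_sub WG] W_sub_conj_closed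
      A.m_inv_consistent[OF subgroup_G_sub] by simp
  moreover have "B_sub k <#>\<^bsub>AutTree k\<lparr>carrier := G_sub k\<rparr>\<^esub> W_sub k = G_sub k"
  proof
    show "B_sub k <#>\<^bsub>AutTree k\<lparr>carrier := G_sub k\<rparr>\<^esub> W_sub k \<subseteq> G_sub k"
      using subsetD[OF BG] subsetD[OF WG] subgroup.m_closed[OF subgroup_G_sub]
      by (auto simp: set_mult_def)
    show "G_sub k \<subseteq> B_sub k <#>\<^bsub>AutTree k\<lparr>carrier := G_sub k\<rparr>\<^esub> W_sub k"
      using G_sub_factorization[OF k] by (fastforce simp: set_mult_def)
  qed
  ultimately show ?thesis
    using B B_inter_W[OF k] by (simp add: inner_semidirect_def)
qed

section \<open>The action by conjugation\<close>

text \<open>Stated for any subgroup \<open>B\<close> normalising a subgroup \<open>W\<close>.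
  Conjugations compose like the conjugating elements, which gives both bijectivity and the
  homomorphism property.\<close>

lemma (in group) conj_map_hom_AutoGroup:
  assumes B: "subgroup B G" and W: "subgroup W G"
    and conj: "\<And>b w. b \<in> B \<Longrightarrow> w \<in> W \<Longrightarrow> b \<otimes> w \<otimes> inv b \<in> W"
  shows "conj_map G W \<in> hom (G\<lparr>carrier := B\<rparr>) (AutoGroup (G\<lparr>carrier := W\<rparr>))"
proof -
  note Bm = subgroup.mem_carrier[OF B] and Wm = subgroup.mem_carrier[OF W]
  have comp: "conj_map G W a (conj_map G W b w) = conj_map G W (a \<otimes> b) w"
    if "a \<in> B" "b \<in> B" "w \<in> W" for a b w
    using that conj by (simp add: conj_map_def Bm Wm m_assoc inv_mult_group)
  have one: "conj_map G W \<one> w = w" if "w \<in> W" for w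
    using that by (simp add: conj_map_def Wm)
  have closed: "conj_map G W b w \<in> W" if "b \<in> B" "w \<in> W" for b w
    using that conj by (simp add: conj_map_def)
  have Bij: "conj_map G W b \<in> Bij W" if b: "b \<in> B" for b
  proof -
    have ib: "inv b \<in> B"
      using subgroup.m_inv_closed[OF B b] .
    have "bij_betw (conj_map G W b) W W"
      \<comment> \<open>Conjugation by \<open>inv b\<close> is the inverse map.\<close>
      by (rule bij_betw_byWitness[where f' = "conj_map G W (inv b)"])
        (use b ib closed comp one Bm in auto)
    then show ?thesis
      by (simp add: Bij_def conj_map_def)
  qed
  have "conj_map G W b \<in> hom (G\<lparr>carrier := W\<rparr>) (G\<lparr>carrier := W\<rparr>)" if b: "b \<in> B" for b
  proof (rule homI)
    fix x y assume "x \<in> carrier (G\<lparr>carrier := W\<rparr>)" "y \<in> carrier (G\<lparr>carrier := W\<rparr>)"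
    then have x: "x \<in> W" and y: "y \<in> W" by auto
    have "b \<otimes> (x \<otimes> y) \<otimes> inv b = (b \<otimes> x \<otimes> inv b) \<otimes> (b \<otimes> y \<otimes> inv b)"
      using Bm[OF b] Wm[OF x] Wm[OF y] by (simp add: m_assoc inv_solve_left)
    then show "conj_map G W b (x \<otimes>\<^bsub>G\<lparr>carrier := W\<rparr>\<^esub> y)
        = conj_map G W b x \<otimes>\<^bsub>G\<lparr>carrier := W\<rparr>\<^esub> conj_map G W b y"
      using x y subgroup.m_closed[OF W x y] by (simp add: conj_map_def)
  qed (use b closed in simp)
  then have auto: "conj_map G W b \<in> auto (G\<lparr>carrier := W\<rparr>)" if "b \<in> B" for b
    using that Bij by (simp add: auto_def)
  show ?thesis
  proof (rule homI)
    fix a b assume "a \<in> carrier (G\<lparr>carrier := B\<rparr>)" "b \<in> carrier (G\<lparr>carrier := B\<rparr>)"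
    then have a: "a \<in> B" and b: "b \<in> B" by auto
    \<comment> \<open>Both sides are \<open>undefined\<close> off \<open>W\<close>, so agreement on
      \<open>W\<close> suffices.\<close>
    have "conj_map G W (a \<otimes> b) = compose W (conj_map G W a) (conj_map G W b)"
    proof (rule extensionalityI[of _ W])
      fix w assume "w \<in> W"
      then show "conj_map G W (a \<otimes> b) w = compose W (conj_map G W a) (conj_map G W b) w"
        using comp[OF a b] by (simp add: compose_def)
    qed (simp_all add: conj_map_def)
    then show "conj_map G W (a \<otimes>\<^bsub>G\<lparr>carrier := B\<rparr>\<^esub> b)
        = conj_map G W a \<otimes>\<^bsub>AutoGroup (G\<lparr>carrier := W\<rparr>)\<^esub> conj_map G W b"
      using Bij[OF a] Bij[OF b] by (simp add: AutoGroup_def BijGroup_def)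
  qed (simp add: AutoGroup_def auto)
qed

theorem theorem1:
  fixes k :: nat
  assumes "k \<ge> 2"
  shows "p_subgroup 2 (G_sub k) (AutTree k) \<and>
    (\<forall>g\<in>G_sub k. even_on_level k g) \<and>
    (\<forall>H. p_subgroup 2 H (AutTree k) \<and> (\<forall>h\<in>H. even_on_level k h) \<longrightarrow> H \<subseteq> G_sub k) \<and>
    inner_semidirect (AutTree k\<lparr>carrier := G_sub k\<rparr>) (B_sub k) (W_sub k) \<and>
    conj_map (AutTree k) (W_sub k)
      \<in> hom (AutTree k\<lparr>carrier := B_sub k\<rparr>) (AutoGroup (AutTree k\<lparr>carrier := W_sub k\<rparr>))"
proof (intro conjI allI impI)
  have k: "k \<ge> 1"
    using assms by simp
  show "p_subgroup 2 (G_sub k) (AutTree k)"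
    by (rule subgroup_AutTree_card[OF subgroup_G_sub])
  show "\<forall>g\<in>G_sub k. even_on_level k g"
    by (simp add: G_sub_def)
  \<comment> \<open>Maximality holds in the strong sense: every 2-subgroup acting evenly on the last
    level is contained in \<open>G_sub k\<close>.\<close>
  show "H \<subseteq> G_sub k" if "p_subgroup 2 H (AutTree k) \<and> (\<forall>h\<in>H. even_on_level k h)" for H
    using that subgroup.subset[of H "AutTree k"] by (auto simp: p_subgroup_def G_sub_def)
  show "inner_semidirect (AutTree k\<lparr>carrier := G_sub k\<rparr>) (B_sub k) (W_sub k)"
    by (rule inner_semidirect_G_sub[OF k])
  show "conj_map (AutTree k) (W_sub k)
      \<in> hom (AutTree k\<lparr>carrier := B_sub k\<rparr>) (AutoGroup (AutTree k\<lparr>carrier := W_sub k\<rparr>))"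
    by (rule group.conj_map_hom_AutoGroup[OF group_AutTree subgroup_B_sub[OF k] subgroup_W_sub])
      (use W_sub_conj_closed B_sub_subset_G_sub[OF k] in blast)
qed

end
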